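(* Let $G$ be a finite group and let $R$ be a $G$-graded regular algebra with commutation function $\theta$. If $\theta(g,g)=-1$ for some $g\in G$, then $\dim R=\infty$.
   Context: $K$ is an algebraically closed field of characteristic different from $2$; all algebras are unital associative $K$-algebras. For $\mathbf{g}=(g_1,\dots,g_n)\in G^n$ let $S_{n,\mathbf{g}}$ be the set of permutations $\sigma\in S_n$ with $g_{\sigma(1)}\cdots g_{\sigma(n)}=g_1\cdots g_n$. A $G$-graded algebra $R=\bigoplus_{g\in G}R_g$ (i.e. $R_gR_h\subseteq R_{gh}$) is a $G$-graded regular algebra if: (1) for every $n\in\mathbb{N}$ and $(g_1,\dots,g_n)\in G^n$ there exist $a_i\in R_{g_i}$, $1\le i\le n$, with $a_1\cdots a_n\neq 0$; (2) for every $n\in\mathbb{N}$, $\mathbf{g}=(g_1,\dots,g_n)\in G^n$ and $\sigma\in S_{n,\mathbf{g}}$ there exists $\theta(\mathbf{g},\sigma)\in K^*$ such that $a_1\cdots a_n=\theta(\mathbf{g},\sigma)\,a_{\sigma(1)}\cdots a_{\sigma(n)}$ for all $a_i\in R_{g_i}$. The function $\theta$ is the commutation function of $R$. For $g\in G$ and $h$ in the centralizer $C_G(g)$ one writes $\theta(g,h)$ for $\theta((g,h),(1\,2))$, so that $ab=\theta(g,h)ba$ for $a\in R_g$, $b\in R_h$. *)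

theory Defs
  imports
    "HOL-Computational_Algebra.Computational_Algebra"
    "HOL-Combinatorics.Permutations"
begin

locale assoc_unital_algebra = vector_space scale
  for scale :: "'k::field \<Rightarrow> 'r::ring_1 \<Rightarrow> 'r"  (infixr \<open>*s\<close> 75) +
  assumes scale_mult_left: "(c *s x) * y = c *s (x * y)"
    and scale_mult_right: "x * (c *s y) = c *s (x * y)"

text \<open>
  The grading group is a type of class \<^class>\<open>group_add\<close>. This class does not assume
  commutativity; the group law is merely written additively, so a product
  \<open>g\<^sub>1 \<dots> g\<^sub>n\<close> of group elements becomes \<^term>\<open>sum_list gs\<close>.
\<close>

locale graded_algebra = assoc_unital_algebra scale
  for scale :: "'k::field \<Rightarrow> 'r::ring_1 \<Rightarrow> 'r"  (infixr \<open>*s\<close> 75) +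
  fixes R :: "'g::group_add \<Rightarrow> 'r set"
  assumes subspace_component: "subspace (R g)"
    and direct_sum:
      "\<exists>!r. (\<forall>g. r g \<in> R g) \<and> finite {g. r g \<noteq> 0} \<and> x = (\<Sum>g | r g \<noteq> 0. r g)"
    and component_mult: "a \<in> R g \<Longrightarrow> b \<in> R h \<Longrightarrow> a * b \<in> R (g + h)"

definition homogeneous_tuple :: "('g \<Rightarrow> 'r set) \<Rightarrow> 'g list \<Rightarrow> 'r list \<Rightarrow> bool" where
  "homogeneous_tuple R gs as \<longleftrightarrow> list_all2 (\<lambda>g a. a \<in> R g) gs as"

text \<open>
  An \<open>n\<close>-tuple is a list of length \<open>n\<close>, so positions are counted from \<open>0\<close>, and
  \<^term>\<open>permute_list \<sigma> as\<close> is the tuple whose \<open>i\<close>-th entry is \<^term>\<open>as ! \<sigma> i\<close>.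
\<close>

definition product_preserving_perms :: "'g::group_add list \<Rightarrow> (nat \<Rightarrow> nat) set" where
  "product_preserving_perms gs =
     {\<sigma>. \<sigma> permutes {..<length gs} \<and> sum_list (permute_list \<sigma> gs) = sum_list gs}"

text \<open>
  The commutation function is a parameter of the locale. Condition \<open>regular_nonzero\<close>
  makes its values on \<^const>\<open>product_preserving_perms\<close> unique.
\<close>

locale graded_regular_algebra = graded_algebra scale R
  for scale :: "'k::field \<Rightarrow> 'r::ring_1 \<Rightarrow> 'r"  (infixr \<open>*s\<close> 75)
    and R :: "'g::group_add \<Rightarrow> 'r set" +
  fixes \<theta> :: "'g list \<Rightarrow> (nat \<Rightarrow> nat) \<Rightarrow> 'k"
  assumes regular_nonzero: "\<exists>as. homogeneous_tuple R gs as \<and> prod_list as \<noteq> 0"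
    and commutation_nonzero: "\<sigma> \<in> product_preserving_perms gs \<Longrightarrow> \<theta> gs \<sigma> \<noteq> 0"
    and commutation:
      "\<sigma> \<in> product_preserving_perms gs \<Longrightarrow> homogeneous_tuple R gs as \<Longrightarrow>
       prod_list as = \<theta> gs \<sigma> *s prod_list (permute_list \<sigma> as)"

definition commutation_factor ::
    "('g list \<Rightarrow> (nat \<Rightarrow> nat) \<Rightarrow> 'k) \<Rightarrow> 'g \<Rightarrow> 'g \<Rightarrow> 'k" where
  "commutation_factor \<theta> g h = \<theta> [g, h] (transpose 0 1)"

lemma (in graded_regular_algebra) commutation_factor:
  assumes "g + h = h + g" "a \<in> R g" "b \<in> R h"
  shows "a * b = commutation_factor \<theta> g h *s (b * a)"
proof -
  have perm: "permute_list (transpose 0 1) [x, y] = [y, x]" for x y :: 'x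
    by (simp add: permute_list_def upt_rec)
  have "transpose 0 1 permutes {..<length [g, h]}"
    by (rule permutes_swap_id) auto
  then have "transpose 0 1 \<in> product_preserving_perms [g, h]"
    using assms(1) by (simp add: product_preserving_perms_def perm del: One_nat_def)
  from commutation[OF this, of "[a, b]"] show ?thesis
    using assms by (simp add: homogeneous_tuple_def commutation_factor_def perm del: One_nat_def)
qed

end

theory Submission
  imports Defs
begin

text \<open>
  Elements of \<open>R g\<close> anticommute when \<open>\<theta> g g = - 1\<close>, and, the characteristic not being \<open>2\<close>, they
  square to zero, so the multiplication restricted to \<open>R g\<close> behaves like an exterior algebra. As
  there, a nonzero product of factors from \<open>R g\<close> forces the factors to be linearly independent
  (\<open>independent_factors\<close>). But \<open>R\<close> is regular: for every \<open>n\<close> some product of \<open>n\<close> elements of \<open>R g\<close>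
  is nonzero, so \<open>R g\<close> contains \<open>n\<close> independent vectors for every \<open>n\<close>.
\<close>

text \<open>
  The left factor can be moved past the others, up to sign, until it meets its other occurrence.
\<close>

lemma anticommuting_repeated_factor:
  fixes A :: "'r::ring_1 set"
  assumes anticommute: "\<And>a b. a \<in> A \<Longrightarrow> b \<in> A \<Longrightarrow> a * b = - (b * a)"
    and square: "\<And>a. a \<in> A \<Longrightarrow> a * a = 0"
    and "set bs \<subseteq> A" "b \<in> set bs"
  shows "b * prod_list bs = 0"
  using assms(3,4)
proof (induction bs)
  case (Cons c cs)
  show ?case
  proof (cases "b = c")
    case True
    with Cons.prems square[of c] show ?thesis
      by (simp flip: mult.assoc)
  next
    case False
    with Cons have "b * prod_list cs = 0" by simp
    moreover have "b * c = - (c * b)"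
      using Cons.prems by (intro anticommute) auto
    ultimately show ?thesis
      by (simp flip: mult.assoc) (simp add: mult.assoc)
  qed
qed simp

text \<open>
  The elements \<open>x\<close> with \<open>x * prod_list bs = 0\<close> form a subspace. By the previous lemma it contains
  every factor of \<open>bs\<close>, hence their span, so a new left factor that keeps the product nonzero lies
  outside this span.
\<close>

lemma (in assoc_unital_algebra) independent_factors:
  assumes anticommute: "\<And>a b. a \<in> A \<Longrightarrow> b \<in> A \<Longrightarrow> a * b = - (b * a)"
    and square: "\<And>a. a \<in> A \<Longrightarrow> a * a = 0"
    and "set as \<subseteq> A" "prod_list as \<noteq> 0"
  shows "distinct as \<and> independent (set as)"
  using assms(3,4)
proof (induction as)
  case (Cons a bs)
  then have "prod_list bs \<noteq> 0" by auto
  with Cons have indep: "distinct bs" "independent (set bs)" by auto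
  let ?Ann = "{x. x * prod_list bs = 0}"
  have "subspace ?Ann"
    by (rule subspaceI) (auto simp: distrib_right scale_mult_left)
  moreover have "set bs \<subseteq> ?Ann"
    using anticommuting_repeated_factor[of A bs, OF anticommute square] Cons.prems by auto
  ultimately have "span (set bs) \<subseteq> ?Ann"
    by (rule span_minimal[rotated])
  with Cons.prems have "a \<notin> span (set bs)" by auto
  with indep show ?case
    using span_base by (auto simp: independent_insert)
qed (simp add: independent_empty)

theorem proposition9:
  fixes scale :: "'k::alg_closed_field \<Rightarrow> 'r::ring_1 \<Rightarrow> 'r"
    and R :: "'g::{group_add, finite} \<Rightarrow> 'r set"
    and \<theta> :: "'g list \<Rightarrow> (nat \<Rightarrow> nat) \<Rightarrow> 'k"
    and g :: 'g
  assumes "CHAR('k) \<noteq> 2"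
    and "graded_regular_algebra scale R \<theta>"
    and "commutation_factor \<theta> g g = - 1"
  shows "\<nexists>B. finite_dimensional_vector_space scale B"
proof
  interpret graded_regular_algebra scale R \<theta> by fact
  assume "\<exists>B. finite_dimensional_vector_space scale B"
  then obtain B where "finite_dimensional_vector_space scale B" ..
  then interpret fd: finite_dimensional_vector_space scale B .
  have anticommute: "a * b = - (b * a)" if "a \<in> R g" "b \<in> R g" for a b
    using commutation_factor[of g g a b] that assms(3) by simp
  have "(of_nat 2 :: 'k) \<noteq> 0"
  proof
    assume "(of_nat 2 :: 'k) = 0"
    then have "CHAR('k) dvd 2" by (simp only: of_nat_eq_0_iff_char_dvd)
    then have "CHAR('k) = 1 \<or> CHAR('k) = 2"
      using two_is_prime_nat unfolding prime_nat_iff by blast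
    with assms(1) show False
      using CHAR_not_1[where 'a = 'k] by simp
  qed
  then have two: "(1 + 1 :: 'k) \<noteq> 0" by simp
  have square: "a * a = 0" if "a \<in> R g" for a
  proof -
    have "scale (1 + 1) (a * a) = a * a + a * a"
      by (simp only: scale_left_distrib scale_one)
    also have "\<dots> = 0"
      using anticommute[OF that that] by (simp add: eq_neg_iff_add_eq_0)
    finally show ?thesis using two by (simp only: scale_eq_0_iff) simp
  qed
  obtain as where hom: "homogeneous_tuple R (replicate (Suc (card B)) g) as"
    and nonzero: "prod_list as \<noteq> 0"
    using regular_nonzero by blast
  have len: "length as = Suc (card B)"
    using hom by (auto simp: homogeneous_tuple_def dest: list_all2_lengthD)
  have "set as \<subseteq> R g"
    using hom unfolding homogeneous_tuple_def list_all2_conv_all_nth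
    by (auto simp: in_set_conv_nth simp del: replicate_Suc)
  from independent_factors[OF anticommute square this nonzero]
  have "distinct as" "independent (set as)" by auto
  then have "length as \<le> card B"
    using independent_span_bound[OF fd.finite_Basis] fd.span_Basis
    by (auto simp flip: distinct_card)
  with len show False by simp
qed

end
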